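(* Let $X$ be a real Hilbert space. In the metric space $(\mathcal M(X),\tilde\rho)$, the set $$\{A\in\mathcal M(X):\ \exists\,\varepsilon>0\text{ such that }A\text{ is }\varepsilon\text{ strongly monotone}\}$$ is of first category.
   Context: $X$ is a real Hilbert space with inner product $\langle\cdot,\cdot\rangle$, norm $\|\cdot\|$ and identity map $\operatorname{Id}$. A set-valued operator $A:X\rightrightarrows X$ with graph $\operatorname{gr}A=\{(x,u):u\in Ax\}$ is monotone if $\langle x-y,u-v\rangle\ge0$ for all $(x,u),(y,v)\in\operatorname{gr}A$, and maximally monotone if it has no proper monotone extension; $\mathcal M(X)$ is the set of maximally monotone operators on $X$. $A$ is $\varepsilon$ strongly monotone ($\varepsilon>0$) if $A-\varepsilon\operatorname{Id}$ is monotone. For $A\in\mathcal M(X)$, the resolvent is $J_A:=(A+\operatorname{Id})^{-1}$ (by Minty's theorem single-valued with domain $X$) and the reflected resolvent is $R_A:=2J_A-\operatorname{Id}$, a nonexpansive map $X\to X$. For nonexpansive maps $S_1,S_2:X\to X$ put $\|S_1-S_2\|_n:=\sup_{\|x\|\le n}\|S_1x-S_2x\|$. The metric on $\mathcal M(X)$ is $$\tilde\rho(A,B):=\sum_{n=1}^\infty\frac1{2^n}\frac{\|R_A-R_B\|_n}{1+\|R_A-R_B\|_n}.$$ A subset of a metric space is of first category if it is a countable union of nowhere dense sets.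
   Formalization: The Hilbert space X is assumed to be different from {0}; for X = {0} the only maximally monotone operator is strongly monotone, so the set is the whole one-point space, which is not of first category. *)

theory Defs
  imports "HOL-Analysis.Analysis"
begin

type_synonym 'a operator = "'a \<Rightarrow> 'a set"

definition gr :: "'a operator \<Rightarrow> ('a \<times> 'a) set" where
  "gr A = {(x, u). u \<in> A x}"

definition monotone_op :: "('a::real_inner) operator \<Rightarrow> bool" where
  "monotone_op A \<longleftrightarrow> (\<forall>(x, u) \<in> gr A. \<forall>(y, v) \<in> gr A. (x - y) \<bullet> (u - v) \<ge> 0)"

definition maximally_monotone :: "('a::real_inner) operator \<Rightarrow> bool" where
  "maximally_monotone A \<longleftrightarrow>
     monotone_op A \<and> \<not> (\<exists>B. monotone_op B \<and> gr A \<subset> gr B)"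

definition max_monotone_ops :: "('a::real_inner) operator set" where
  "max_monotone_ops = {A. maximally_monotone A}"

definition op_plus_scaled_Id :: "('a::real_inner) operator \<Rightarrow> real \<Rightarrow> 'a operator" where
  "op_plus_scaled_Id A c = (\<lambda>x. {u + c *\<^sub>R x | u. u \<in> A x})"

definition strongly_monotone_op :: "real \<Rightarrow> ('a::real_inner) operator \<Rightarrow> bool" where
  "strongly_monotone_op \<epsilon> A \<longleftrightarrow> monotone_op (op_plus_scaled_Id A (- \<epsilon>))"

definition op_inverse :: "'a operator \<Rightarrow> 'a operator" where
  "op_inverse A = (\<lambda>u. {x. u \<in> A x})"

definition resolvent_op :: "('a::real_inner) operator \<Rightarrow> 'a operator" where
  "resolvent_op A = op_inverse (op_plus_scaled_Id A 1)"

text \<open>For maximally monotone \<open>A\<close> on a Hilbert space every value of \<open>resolvent_op A\<close> is a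
  singleton (Minty), and \<open>resolvent A\<close> is the corresponding map; it is unspecified where
  the value is not a singleton.\<close>
definition resolvent :: "('a::real_inner) operator \<Rightarrow> 'a \<Rightarrow> 'a" where
  "resolvent A x = the_elem (resolvent_op A x)"

definition reflected_resolvent :: "('a::real_inner) operator \<Rightarrow> 'a \<Rightarrow> 'a" where
  "reflected_resolvent A x = 2 *\<^sub>R resolvent A x - x"

definition norm_dist_on_ball :: "nat \<Rightarrow> ('a::real_inner \<Rightarrow> 'a) \<Rightarrow> ('a \<Rightarrow> 'a) \<Rightarrow> real" where
  "norm_dist_on_ball n S\<^sub>1 S\<^sub>2 = (SUP x \<in> {x. norm x \<le> real n}. norm (S\<^sub>1 x - S\<^sub>2 x))"

text \<open>The index is shifted so that the series starts at \<open>n = 1\<close>. The locale \<open>Metric_space\<close>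
  requires a distance to be nonnegative on the whole type, hence the value \<open>0\<close> outside
  \<open>max_monotone_ops\<close>, where the reflected resolvents carry no meaning.\<close>
definition rho_tilde :: "('a::real_inner) operator \<Rightarrow> 'a operator \<Rightarrow> real" where
  "rho_tilde A B =
     (if A \<in> max_monotone_ops \<and> B \<in> max_monotone_ops then
        (\<Sum>n. 1 / 2 ^ Suc n *
          (norm_dist_on_ball (Suc n) (reflected_resolvent A) (reflected_resolvent B) /
           (1 + norm_dist_on_ball (Suc n) (reflected_resolvent A) (reflected_resolvent B))))
      else 0)"

definition nowhere_dense_in :: "'b topology \<Rightarrow> 'b set \<Rightarrow> bool" where
  "nowhere_dense_in T N \<longleftrightarrow> N \<subseteq> topspace T \<and> T interior_of (T closure_of N) = {}"

definition first_category_in :: "'b topology \<Rightarrow> 'b set \<Rightarrow> bool" where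
  "first_category_in T S \<longleftrightarrow>
     (\<exists>\<N>. countable \<N> \<and> (\<forall>N \<in> \<N>. nowhere_dense_in T N) \<and> S = \<Union>\<N>)"

end

theory Submission
  imports Defs
begin

text \<open>
  The set of strongly monotone operators is the union, over \<open>\<epsilon> = 1, 1/2, 1/3, \<dots>\<close>, of the sets
  of \<open>\<epsilon>\<close> strongly monotone operators, and each of these is nowhere dense: it is closed and has
  empty interior. Both facts are read off from the reflected resolvent \<open>R\<close> of \<open>A\<close>. Writing a point
  of the graph as \<open>(x, u)\<close> with \<open>x + u = p\<close> and \<open>x - u = R p\<close>, the polarisation identity turns
  \<open>\<epsilon>\<close> strong monotonicity into
  \<open>\<epsilon> \<parallel>(p - q) + (R p - R q)\<parallel>\<^sup>2 \<le> \<parallel>p - q\<parallel>\<^sup>2 - \<parallel>R p - R q\<parallel>\<^sup>2\<close> for all \<open>p, q\<close>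
  (\<open>strongly_monotone_iff_reflected_resolvent\<close>). This condition survives pointwise limits of \<open>R\<close>,
  and convergence in the metric implies pointwise convergence, so the set is closed.

  For the empty interior, it suffices to find near any \<open>A\<close> an operator \<open>B\<close> with
  \<open>R\<^sub>B p - R\<^sub>B 0 = p\<close> for some \<open>p \<noteq> 0\<close>, because then the condition fails at \<open>p\<close> and \<open>0\<close>
  (\<open>ex_close_isometric_pair\<close>). Replace \<open>R\<^sub>A\<close> by the contraction \<open>T = (1 - \<delta>) R\<^sub>A\<close>, keep \<open>T\<close>
  at \<open>0\<close> and outside a small ball of radius \<open>r\<close> about \<open>0\<close>, and prescribe the value \<open>T 0 + p\<close> at
  one point \<open>p\<close> with \<open>0 < \<parallel>p\<parallel>\<close> much smaller than \<open>r\<close>. The slack of the contraction keeps this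
  partial map nonexpansive, so it extends to the reflected resolvent of a maximally monotone
  operator: nonexpansive partial maps correspond to monotone graphs, which have maximal extensions
  by Zorn's lemma.

  That resolvents are defined everywhere is Minty's theorem, proved here through the Fitzpatrick
  function: the minimiser of this function plus half the squared norm on \<open>X \<times> X\<close>
  exhibits the required point of the graph (\<open>zero_in_range_plus_Id\<close>).
\<close>

section \<open>Minty's theorem\<close>

text \<open>
  The supremum of a family of functions \<open>z \<mapsto> z \<bullet> k - d + \<parallel>z\<parallel>\<^sup>2 / 2\<close> that is bounded below and
  somewhere finite attains its minimum \<open>m\<close> and grows at least quadratically away from the
  minimiser. The supremum, which may be infinite, is represented by its sublevel sets \<open>L c\<close>.
\<close>

lemma quadratic_family_minimizer:
  fixes K :: "('h::{real_inner, complete_space} \<times> real) set"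
  defines "L \<equiv> \<lambda>c. {z. \<forall>(k, d) \<in> K. z \<bullet> k - d + (z \<bullet> z) / 2 \<le> c}"
  assumes ne: "L c1 \<noteq> {}" and bdd: "\<And>c. L c \<noteq> {} \<Longrightarrow> b \<le> c"
  obtains z m where "z \<in> L m" and "\<And>w c. w \<in> L c \<Longrightarrow> m + ((w - z) \<bullet> (w - z)) / 2 \<le> c"
proof -
  \<comment> \<open>This is strong convexity of the supremum.\<close>
  have comb: "(1 - t) *\<^sub>R z + t *\<^sub>R w \<in> L ((1 - t) * c + t * d - t * (1 - t) * ((w - z) \<bullet> (w - z)) / 2)"
    if z: "z \<in> L c" and w: "w \<in> L d" and t: "0 \<le> t" "t \<le> 1" for z w c d t
  proof -
    have "((1 - t) *\<^sub>R z + t *\<^sub>R w) \<bullet> k - e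
          + (((1 - t) *\<^sub>R z + t *\<^sub>R w) \<bullet> ((1 - t) *\<^sub>R z + t *\<^sub>R w)) / 2
        \<le> (1 - t) * c + t * d - t * (1 - t) * ((w - z) \<bullet> (w - z)) / 2"
      if "(k, e) \<in> K" for k e
    proof -
      have "(1 - t) * (z \<bullet> k - e + (z \<bullet> z) / 2) \<le> (1 - t) * c"
        using z that t by (intro mult_left_mono) (auto simp: L_def)
      moreover have "t * (w \<bullet> k - e + (w \<bullet> w) / 2) \<le> t * d"
        using w that t by (intro mult_left_mono) (auto simp: L_def)
      moreover have "((1 - t) *\<^sub>R z + t *\<^sub>R w) \<bullet> k - e
          + (((1 - t) *\<^sub>R z + t *\<^sub>R w) \<bullet> ((1 - t) *\<^sub>R z + t *\<^sub>R w)) / 2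
        = (1 - t) * (z \<bullet> k - e + (z \<bullet> z) / 2) + t * (w \<bullet> k - e + (w \<bullet> w) / 2)
          - t * (1 - t) * ((w - z) \<bullet> (w - z)) / 2"
        by (simp add: inner_add_left inner_add_right inner_diff_left inner_diff_right
            inner_commute[of w z]) (simp add: field_simps)
      ultimately show ?thesis by linarith
    qed
    then show ?thesis by (auto simp: L_def)
  qed
  define m where "m = Inf {c. L c \<noteq> {}}"
  have bb: "bdd_below {c. L c \<noteq> {}}" by (rule bdd_belowI[of _ b]) (use bdd in auto)
  have m_le: "m \<le> c" if "w \<in> L c" for w c
    unfolding m_def using that by (intro cInf_lower bb) auto
  define S where "S = (\<lambda>n. L (m + 1 / real (Suc n)))"
  have "closed (S n)" for n
  proof -
    have "S n = (\<Inter>q \<in> K. {z. z \<bullet> fst q - snd q + (z \<bullet> z) / 2 \<le> m + 1 / real (Suc n)})"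
      by (fastforce simp: S_def L_def)
    moreover have "closed {z. z \<bullet> k - d + (z \<bullet> z) / 2 \<le> m + 1 / real (Suc n)}" for k :: 'h and d
      by (intro closed_Collect_le continuous_intros) simp
    ultimately show ?thesis by (simp add: closed_INT)
  qed
  moreover have "S n \<noteq> {}" for n
  proof -
    have "m < m + 1 / real (Suc n)" by simp
    then obtain c where c: "L c \<noteq> {}" "c < m + 1 / real (Suc n)"
      using cInf_lessD[of "{c. L c \<noteq> {}}"] ne unfolding m_def by blast
    then have "L c \<subseteq> S n" by (fastforce simp: S_def L_def)
    with c show ?thesis by auto
  qed
  moreover have "S n \<subseteq> S k" if "k \<le> n" for k n
  proof -
    have "1 / real (Suc n) \<le> 1 / real (Suc k)" using that by (simp add: frac_le)
    then show ?thesis by (fastforce simp: S_def L_def)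
  qed
  moreover have "\<exists>n. \<forall>z\<in>S n. \<forall>w\<in>S n. dist z w < e" if "e > 0" for e
  proof -
    obtain n where n: "8 / e\<^sup>2 < real n" using reals_Archimedean2 by blast
    \<comment> \<open>Compare \<open>m\<close> with the value at the midpoint of two approximate minimisers.\<close>
    have "dist z w < e" if zw: "z \<in> S n" "w \<in> S n" for z w
    proof -
      have "m \<le> m + 1 / real (Suc n) - ((w - z) \<bullet> (w - z)) / 8"
        using m_le[OF comb[of z _ w _ "1/2"]] zw[unfolded S_def] by fastforce
      then have "(dist z w)\<^sup>2 \<le> 8 / real (Suc n)"
        by (simp add: dist_norm norm_minus_commute power2_norm_eq_inner)
      also have "\<dots> < e\<^sup>2"
      proof -
        have "8 / e\<^sup>2 < real (Suc n)" using n by simp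
        then show ?thesis using \<open>e > 0\<close> by (simp add: field_simps)
      qed
      finally show ?thesis by (rule power2_less_imp_less) (use \<open>e > 0\<close> in simp)
    qed
    then show ?thesis by blast
  qed
  ultimately obtain z where z: "\<And>n. z \<in> S n"
    using decreasing_closed_nest[of S] by metis
  have zm: "z \<in> L m"
  proof -
    have "z \<bullet> k - d + (z \<bullet> z) / 2 \<le> m" if "(k, d) \<in> K" for k d
    proof (rule LIMSEQ_le_const)
      show "(\<lambda>n. m + 1 / real (Suc n)) \<longlonglongrightarrow> m"
        using tendsto_add[OF tendsto_const LIMSEQ_inverse_real_of_nat, of m]
        by (simp add: inverse_eq_divide)
      show "\<exists>N. \<forall>n\<ge>N. z \<bullet> k - d + (z \<bullet> z) / 2 \<le> m + 1 / real (Suc n)"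
        using z that by (fastforce simp: S_def L_def)
    qed
    then show ?thesis by (auto simp: L_def)
  qed
  have "m + ((w - z) \<bullet> (w - z)) / 2 \<le> c" if w: "w \<in> L c" for w c
  proof -
    define q where "q = ((w - z) \<bullet> (w - z)) / 2"
    \<comment> \<open>Compare \<open>z\<close> with points of the segment from \<open>z\<close> to \<open>w\<close>, then let \<open>t\<close> tend to \<open>0\<close>.\<close>
    have *: "m + (1 - t) * q \<le> c" if t: "0 < t" "t \<le> 1" for t :: real
    proof -
      have "m \<le> (1 - t) * m + t * c - t * (1 - t) * ((w - z) \<bullet> (w - z)) / 2"
        using m_le comb[OF zm w] t by (meson less_imp_le)
      then have "t * (m + (1 - t) * q) \<le> t * c" by (simp add: q_def algebra_simps)
      then show ?thesis using t by simp
    qed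
    have "m + q \<le> c"
    proof (rule LIMSEQ_le_const2)
      show "(\<lambda>n. m + (1 - inverse (real (Suc n))) * q) \<longlonglongrightarrow> m + q"
        using tendsto_add[OF tendsto_const tendsto_mult[OF tendsto_diff[OF tendsto_const
              LIMSEQ_inverse_real_of_nat] tendsto_const], of m 1 q] by simp
      show "\<exists>N. \<forall>n\<ge>N. m + (1 - inverse (real (Suc n))) * q \<le> c"
        using * by (auto simp: inverse_le_1_iff)
    qed
    then show ?thesis by (simp add: q_def)
  qed
  with zm show thesis using that by blast
qed

text \<open>
  Here \<open>L\<close> describes the sublevel sets of the Fitzpatrick function
  \<open>F (x, u) = sup {x \<bullet> b + a \<bullet> u - a \<bullet> b | (a, b) \<in> G}\<close> plus \<open>(\<parallel>x\<parallel>\<^sup>2 + \<parallel>u\<parallel>\<^sup>2) / 2\<close>. Maximality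
  gives \<open>F (x, u) \<ge> x \<bullet> u\<close>, and monotonicity gives equality on \<open>G\<close>. Comparing the minimiser
  \<open>(x, u)\<close> with the points of \<open>G\<close> shows that \<open>(- u, - x)\<close> is monotonically related to \<open>G\<close>, hence
  belongs to it, and finally that \<open>u = - x\<close>.
\<close>

lemma zero_in_range_plus_Id:
  fixes G :: "('a::{real_inner, complete_space} \<times> 'a) set"
  assumes mono: "\<And>x u y v. (x, u) \<in> G \<Longrightarrow> (y, v) \<in> G \<Longrightarrow> (x - y) \<bullet> (u - v) \<ge> 0"
    and max: "\<And>x u. (\<And>y v. (y, v) \<in> G \<Longrightarrow> (x - y) \<bullet> (u - v) \<ge> 0) \<Longrightarrow> (x, u) \<in> G"
  shows "\<exists>x. (x, - x) \<in> G"
proof -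
  define K where "K = (\<lambda>(a, b). ((b, a), a \<bullet> b)) ` G"
  define L where "L = (\<lambda>c. {z. \<forall>(k, d) \<in> K. z \<bullet> k - d + (z \<bullet> z) / 2 \<le> c})"
  have L_iff: "(x, u) \<in> L c \<longleftrightarrow>
      (\<forall>(a, b) \<in> G. x \<bullet> b + u \<bullet> a - a \<bullet> b + (x \<bullet> x + u \<bullet> u) / 2 \<le> c)" for x u c
    by (auto simp: L_def K_def)
  have G_L: "(a, b) \<in> L (a \<bullet> b + (a \<bullet> a + b \<bullet> b) / 2)" if "(a, b) \<in> G" for a b
    unfolding L_iff using mono[OF that]
    by (fastforce simp: inner_diff_left inner_diff_right inner_commute)
  have below: "x \<bullet> u + (x \<bullet> x + u \<bullet> u) / 2 \<le> c" if xu: "(x, u) \<in> L c" for x u c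
  proof (cases "(x, u) \<in> G")
    case True
    then show ?thesis using xu unfolding L_iff by (fastforce simp: inner_commute)
  next
    case False
    then obtain a b where ab: "(a, b) \<in> G" "(x - a) \<bullet> (u - b) < 0" 
      using max[of x u] by (meson not_le)
    have "x \<bullet> b + u \<bullet> a - a \<bullet> b + (x \<bullet> x + u \<bullet> u) / 2 \<le> c"
      using xu ab(1) unfolding L_iff by blast
    with ab(2) show ?thesis by (simp add: inner_diff_left inner_diff_right inner_commute)
  qed
  have square: "0 \<le> x \<bullet> u + (x \<bullet> x + u \<bullet> u) / 2" for x u :: 'a
    using inner_ge_zero[of "x + u"]
    by (simp add: inner_add_left inner_add_right inner_commute field_simps)
  obtain a0 b0 where "(a0, b0) \<in> G" using max by fast
  then have "L (a0 \<bullet> b0 + (a0 \<bullet> a0 + b0 \<bullet> b0) / 2) \<noteq> {}" using G_L by blast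
  moreover have "0 \<le> c" if ne: "L c \<noteq> {}" for c
  proof -
    obtain x u where "(x, u) \<in> L c" using ne by (metis ex_in_conv surj_pair)
    then show ?thesis using below square order_trans by blast
  qed
  ultimately obtain z m where z: "z \<in> L m"
    and min: "\<And>w c. w \<in> L c \<Longrightarrow> m + ((w - z) \<bullet> (w - z)) / 2 \<le> c"
    using quadratic_family_minimizer[of K "a0 \<bullet> b0 + (a0 \<bullet> a0 + b0 \<bullet> b0) / 2" 0]
    unfolding L_def by blast
  obtain x u where [simp]: "z = (x, u)" by (cases z)
  have key: "(x + u) \<bullet> (x + u) \<le> (- u - a) \<bullet> (- x - b)" if ab: "(a, b) \<in> G" for a b
    using below[of x u m] z min[OF G_L[OF ab]]
    by (simp add: inner_diff_left inner_diff_right inner_add_left inner_add_right inner_commute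
        field_simps)
  have mem: "(- u, - x) \<in> G"
    using key order_trans[OF inner_ge_zero[of "x + u"]] by (intro max) blast
  then have "(x + u) \<bullet> (x + u) \<le> 0" using key[OF mem] by simp
  then have "u = - x" using inner_eq_zero_iff[of "x + u"] inner_ge_zero[of "x + u"]
    by (metis add_eq_0_iff order_antisym)
  with mem show ?thesis by auto
qed

lemma monotone_opD:
  "monotone_op A \<Longrightarrow> u \<in> A x \<Longrightarrow> v \<in> A y \<Longrightarrow> 0 \<le> (x - y) \<bullet> (u - v)"
  by (fastforce simp: monotone_op_def gr_def)

lemma monotone_opI:
  "(\<And>x u y v. u \<in> A x \<Longrightarrow> v \<in> A y \<Longrightarrow> 0 \<le> (x - y) \<bullet> (u - v)) \<Longrightarrow> monotone_op A"
  by (auto simp: monotone_op_def gr_def)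

text \<open>A maximally monotone operator contains every point monotonically related to its graph.\<close>

lemma maximally_monotone_mem:
  assumes A: "maximally_monotone A" and rel: "\<And>y v. v \<in> A y \<Longrightarrow> 0 \<le> (x - y) \<bullet> (u - v)"
  shows "u \<in> A x"
proof (rule ccontr)
  assume nu: "u \<notin> A x"
  define B where "B = (\<lambda>y. if y = x then insert u (A y) else A y)"
  have mono: "monotone_op A" using A by (simp add: maximally_monotone_def)
  have rel': "0 \<le> (y - x) \<bullet> (v - u)" if "v \<in> A y" for y v
    using rel[OF that] by (simp add: inner_diff_left inner_diff_right)
  have "monotone_op B"
    by (rule monotone_opI)
      (auto simp: B_def split: if_splits intro: rel rel' monotone_opD[OF mono]
        dest: rel rel' monotone_opD[OF mono])
  moreover have "gr A \<subset> gr B" using nu by (auto simp: gr_def B_def)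
  ultimately show False using A by (auto simp: maximally_monotone_def)
qed

text \<open>Uniqueness in Minty's theorem says that the resolvent is single-valued, existence that its
  domain is the whole space.\<close>

theorem Minty:
  fixes A :: "('a::{real_inner, complete_space}) operator"
  assumes A: "maximally_monotone A"
  shows "\<exists>!x. p - x \<in> A x"
proof -
  have mono: "monotone_op A" using A by (simp add: maximally_monotone_def)
  define G where "G = {(x, u). u + p \<in> A x}"
  have "\<exists>x. (x, - x) \<in> G"
  proof (rule zero_in_range_plus_Id)
    show "(x - y) \<bullet> (u - v) \<ge> 0" if "(x, u) \<in> G" "(y, v) \<in> G" for x u y v
      using monotone_opD[OF mono, of "u + p" x "v + p" y] that by (simp add: G_def)
    show "(x, u) \<in> G" if *: "\<And>y v. (y, v) \<in> G \<Longrightarrow> (x - y) \<bullet> (u - v) \<ge> 0" for x u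
    proof -
      have "u + p \<in> A x"
      proof (rule maximally_monotone_mem[OF A])
        show "0 \<le> (x - y) \<bullet> (u + p - v)" if "v \<in> A y" for y v
          using *[of y "v - p"] that by (simp add: G_def algebra_simps)
      qed
      then show ?thesis by (simp add: G_def)
    qed
  qed
  then obtain x where x: "p - x \<in> A x" by (auto simp: G_def)
  moreover have "y = x" if y: "p - y \<in> A y" for y
  proof -
    have "0 \<le> (y - x) \<bullet> ((p - y) - (p - x))" using monotone_opD[OF mono y x] .
    also have "(p - y) - (p - x) = - (y - x)" by simp
    finally have "(y - x) \<bullet> (y - x) \<le> 0" by (simp only: inner_minus_right)
    then show ?thesis using inner_eq_zero_iff[of "y - x"] inner_ge_zero[of "y - x"] by auto
  qed
  ultimately show ?thesis by blast
qed

section \<open>Operators and their reflected resolvents\<close>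

lemma resolvent_eqI:
  fixes A :: "('a::{real_inner, complete_space}) operator"
  assumes A: "maximally_monotone A" and "p - x \<in> A x"
  shows "resolvent A p = x"
proof -
  have "resolvent_op A p = {y. p - y \<in> A y}"
    by (force simp: resolvent_op_def op_inverse_def op_plus_scaled_Id_def)
  also have "\<dots> = {x}" using Minty[OF A, of p] assms(2) by blast
  finally show ?thesis by (simp add: resolvent_def)
qed

lemma resolvent_mem:
  fixes A :: "('a::{real_inner, complete_space}) operator"
  assumes "maximally_monotone A"
  shows "p - resolvent A p \<in> A (resolvent A p)"
  using Minty[OF assms] resolvent_eqI[OF assms] by metis

lemma mem_iff_reflected_resolvent:
  fixes A :: "('a::{real_inner, complete_space}) operator"
  assumes "maximally_monotone A"
  shows "u \<in> A x \<longleftrightarrow> reflected_resolvent A (x + u) = x - u"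
proof -
  have "u \<in> A x \<longleftrightarrow> resolvent A (x + u) = x"
    using resolvent_mem[OF assms, of "x + u"] resolvent_eqI[OF assms, of "x + u" x] by auto
  also have "\<dots> \<longleftrightarrow> 2 *\<^sub>R resolvent A (x + u) = 2 *\<^sub>R x" by simp
  also have "\<dots> \<longleftrightarrow> reflected_resolvent A (x + u) = x - u"
    by (auto simp: reflected_resolvent_def scaleR_2 algebra_simps)
  finally show ?thesis .
qed

lemma graph_reflected_resolvent:
  fixes A :: "('a::{real_inner, complete_space}) operator"
  assumes "maximally_monotone A"
  obtains x u where "u \<in> A x" "x + u = p" "x - u = reflected_resolvent A p"
  using that[of "p - resolvent A p" "resolvent A p"] resolvent_mem[OF assms, of p]
  by (simp add: reflected_resolvent_def scaleR_2)

lemma norm_add_diff_norm_diff: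
  fixes a b :: "'a::real_inner"
  shows "(norm (a + b))\<^sup>2 - (norm (a - b))\<^sup>2 = 4 * (a \<bullet> b)"
  by (simp add: power2_norm_eq_inner inner_add_left inner_add_right inner_diff_left
      inner_diff_right inner_commute)

lemma reflected_resolvent_nonexpansive:
  fixes A :: "('a::{real_inner, complete_space}) operator"
  assumes A: "maximally_monotone A"
  shows "norm (reflected_resolvent A p - reflected_resolvent A q) \<le> norm (p - q)"
proof -
  obtain x u where xu: "u \<in> A x" "x + u = p" "x - u = reflected_resolvent A p"
    using graph_reflected_resolvent[OF A] .
  obtain y v where yv: "v \<in> A y" "y + v = q" "y - v = reflected_resolvent A q"
    using graph_reflected_resolvent[OF A] .
  have "0 \<le> (x - y) \<bullet> (u - v)"
    using monotone_opD xu(1) yv(1) A by (auto simp: maximally_monotone_def)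
  moreover have "(x - y) + (u - v) = p - q" using xu(2) yv(2) by auto
  moreover have "(x - y) - (u - v) = reflected_resolvent A p - reflected_resolvent A q"
    using xu(3)[symmetric] yv(3)[symmetric] by simp
  ultimately have "(norm (reflected_resolvent A p - reflected_resolvent A q))\<^sup>2 \<le> (norm (p - q))\<^sup>2"
    using norm_add_diff_norm_diff[of "x - y" "u - v"]
    by (metis diff_ge_0_iff_ge mult_nonneg_nonneg zero_le_numeral)
  then show ?thesis by (rule power2_le_imp_le) simp
qed

lemma strongly_monotone_op_iff:
  "strongly_monotone_op \<epsilon> A \<longleftrightarrow>
     (\<forall>x y. \<forall>u \<in> A x. \<forall>v \<in> A y. \<epsilon> * ((x - y) \<bullet> (x - y)) \<le> (x - y) \<bullet> (u - v))"
proof -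
  have "strongly_monotone_op \<epsilon> A \<longleftrightarrow>
     (\<forall>x y. \<forall>u \<in> A x. \<forall>v \<in> A y. 0 \<le> (x - y) \<bullet> ((u - \<epsilon> *\<^sub>R x) - (v - \<epsilon> *\<^sub>R y)))"
    by (fastforce simp: strongly_monotone_op_def monotone_op_def gr_def op_plus_scaled_Id_def)
  moreover have "(u - \<epsilon> *\<^sub>R x) - (v - \<epsilon> *\<^sub>R y) = (u - v) - \<epsilon> *\<^sub>R (x - y)" for x y u v :: 'a
    by (simp add: algebra_simps)
  ultimately show ?thesis by (simp add: inner_diff_right del: diff_diff_eq)
qed

lemma strongly_monotone_iff_reflected_resolvent:
  fixes A :: "('a::{real_inner, complete_space}) operator"
  assumes A: "maximally_monotone A"
  defines "R \<equiv> reflected_resolvent A"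
  shows "strongly_monotone_op \<epsilon> A \<longleftrightarrow>
    (\<forall>p q. \<epsilon> * (norm ((p - q) + (R p - R q)))\<^sup>2 \<le> (norm (p - q))\<^sup>2 - (norm (R p - R q))\<^sup>2)"
    (is "_ \<longleftrightarrow> ?rhs")
proof -
  have eq: "\<epsilon> * (norm ((p - q) + (R p - R q)))\<^sup>2 \<le> (norm (p - q))\<^sup>2 - (norm (R p - R q))\<^sup>2
      \<longleftrightarrow> \<epsilon> * ((x - y) \<bullet> (x - y)) \<le> (x - y) \<bullet> (u - v)"
    if "x + u = p" "x - u = R p" "y + v = q" "y - v = R q" for x u y v p q
  proof -
    have "(x - y) + (u - v) = (x + u) - (y + v)" "(x - y) - (u - v) = (x - u) - (y - v)"
      "((x + u) - (y + v)) + ((x - u) - (y - v)) = 2 *\<^sub>R (x - y)"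
      by (simp_all add: scaleR_2)
    then have 1: "(x - y) + (u - v) = p - q" "(x - y) - (u - v) = R p - R q"
      "(p - q) + (R p - R q) = 2 *\<^sub>R (x - y)"
      by (simp_all only: that)
    have "(norm (p - q))\<^sup>2 - (norm (R p - R q))\<^sup>2 = 4 * ((x - y) \<bullet> (u - v))"
      using norm_add_diff_norm_diff[of "x - y" "u - v"] unfolding 1 .
    moreover have "(norm ((p - q) + (R p - R q)))\<^sup>2 = 4 * ((x - y) \<bullet> (x - y))"
      unfolding 1(3) by (simp add: power2_norm_eq_inner)
    ultimately show ?thesis by simp
  qed
  show ?thesis
  proof
    assume *: "strongly_monotone_op \<epsilon> A"
    show ?rhs
    proof (intro allI)
      fix p q
      obtain x u where xu: "u \<in> A x" "x + u = p" "x - u = R p"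
        using graph_reflected_resolvent[OF A] unfolding R_def .
      obtain y v where yv: "v \<in> A y" "y + v = q" "y - v = R q"
        using graph_reflected_resolvent[OF A] unfolding R_def .
      show "\<epsilon> * (norm ((p - q) + (R p - R q)))\<^sup>2 \<le> (norm (p - q))\<^sup>2 - (norm (R p - R q))\<^sup>2"
        using eq[OF xu(2,3) yv(2,3)] * xu(1) yv(1) by (auto simp: strongly_monotone_op_iff)
    qed
  next
    assume *: ?rhs
    show "strongly_monotone_op \<epsilon> A"
      unfolding strongly_monotone_op_iff
    proof (intro allI ballI)
      fix x y u v assume "u \<in> A x" "v \<in> A y"
      then have "x - u = R (x + u)" "y - v = R (y + v)"
        using mem_iff_reflected_resolvent[OF A] by (auto simp: R_def)
      then show "\<epsilon> * ((x - y) \<bullet> (x - y)) \<le> (x - y) \<bullet> (u - v)"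
        using eq[OF refl _ refl] * by blast
    qed
  qed
qed

section \<open>Extension of monotone operators and nonexpansive maps\<close>

lemma ex_maximally_monotone_extension:
  fixes A :: "('a::real_inner) operator"
  assumes "monotone_op A"
  obtains B where "maximally_monotone B" "gr A \<subseteq> gr B"
proof -
  define mon where "mon = (\<lambda>G :: ('a \<times> 'a) set. monotone_op (\<lambda>x. G `` {x}))"
  \<comment> \<open>Operators correspond to their graphs; Zorn's lemma is applied to graphs ordered by inclusion.\<close>
  have gr_of [simp]: "gr (\<lambda>x. G `` {x}) = G" for G :: "('a \<times> 'a) set"
    by (auto simp: gr_def)
  have of_gr: "(\<lambda>x. gr B `` {x}) = B" for B :: "'a operator"
    by (auto simp: gr_def)
  define P where "P = {G. mon G \<and> gr A \<subseteq> G}"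
  have "\<exists>M\<in>P. \<forall>G\<in>P. M \<subseteq> G \<longrightarrow> G = M"
  proof (rule subset_Zorn_nonempty)
    have "gr A \<in> P" unfolding P_def mon_def mem_Collect_eq of_gr using assms by simp
    then show "P \<noteq> {}" by blast
    fix C assume ne: "C \<noteq> {}" and C: "subset.chain P C"
    have "monotone_op (\<lambda>x. (\<Union>C) `` {x})"
    proof (rule monotone_opI)
      fix x u y v assume "u \<in> (\<Union>C) `` {x}" "v \<in> (\<Union>C) `` {y}"
      then obtain G H where GH: "G \<in> C" "(x, u) \<in> G" "H \<in> C" "(y, v) \<in> H" by auto
      moreover have "G \<subseteq> H \<or> H \<subseteq> G" using C GH(1,3) by (auto simp: subset.chain_def)
      ultimately obtain K where "K \<in> C" "(x, u) \<in> K" "(y, v) \<in> K" by blast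
      moreover from this have "mon K" using C by (auto simp: subset.chain_def P_def)
      ultimately show "0 \<le> (x - y) \<bullet> (u - v)"
        unfolding mon_def by (auto elim: monotone_opD)
    qed
    moreover have "gr A \<subseteq> \<Union>C" using ne C by (fastforce simp: subset.chain_def P_def)
    ultimately show "\<Union>C \<in> P" by (auto simp: P_def mon_def)
  qed
  then obtain M where M: "M \<in> P" "\<And>G. G \<in> P \<Longrightarrow> M \<subseteq> G \<Longrightarrow> G = M" by blast
  have "maximally_monotone (\<lambda>x. M `` {x})"
    unfolding maximally_monotone_def
  proof (intro conjI notI)
    show "monotone_op (\<lambda>x. M `` {x})" using M(1) by (simp add: P_def mon_def)
    assume "\<exists>B. monotone_op B \<and> gr (\<lambda>x. M `` {x}) \<subset> gr B"
    then obtain B where B: "monotone_op B" "M \<subset> gr B" by auto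
    then have "gr B \<in> P" using M(1) unfolding P_def mon_def mem_Collect_eq of_gr by blast
    then show False using M(2)[of "gr B"] B(2) by auto
  qed
  moreover have "gr A \<subseteq> gr (\<lambda>x. M `` {x})" using M(1) by (simp add: P_def)
  ultimately show thesis by (rule that)
qed

text \<open>
  A version of the Kirszbraun--Valentine theorem: nonexpansive maps on \<open>D\<close> are restrictions of
  reflected resolvents. The pair \<open>(p, T p)\<close> corresponds to the point
  \<open>((p + T p) / 2, (p - T p) / 2)\<close> of a monotone graph.
\<close>

lemma nonexpansive_extension:
  fixes T :: "'a::{real_inner, complete_space} \<Rightarrow> 'a"
  assumes T: "\<And>p q. p \<in> D \<Longrightarrow> q \<in> D \<Longrightarrow> norm (T p - T q) \<le> norm (p - q)"
  obtains B where "maximally_monotone B" "\<And>p. p \<in> D \<Longrightarrow> reflected_resolvent B p = T p"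
proof -
  define A where "A = (\<lambda>x. {u. x + u \<in> D \<and> T (x + u) = x - u})"
  have "monotone_op A"
  proof (rule monotone_opI)
    fix x u y v assume "u \<in> A x" "v \<in> A y"
    then have "norm ((x - u) - (y - v)) \<le> norm ((x + u) - (y + v))"
      using T[of "x + u" "y + v"] by (simp add: A_def)
    then have "norm ((x - y) - (u - v)) \<le> norm ((x - y) + (u - v))"
      by (simp add: algebra_simps)
    then have "(norm ((x - y) - (u - v)))\<^sup>2 \<le> (norm ((x - y) + (u - v)))\<^sup>2"
      by (simp add: power_mono)
    then show "0 \<le> (x - y) \<bullet> (u - v)"
      using norm_add_diff_norm_diff[of "x - y" "u - v"] by linarith
  qed
  then obtain B where B: "maximally_monotone B" "gr A \<subseteq> gr B"
    using ex_maximally_monotone_extension by blast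
  have "reflected_resolvent B p = T p" if "p \<in> D" for p
  proof -
    define x u where "x = (1/2) *\<^sub>R (p + T p)" and "u = (1/2) *\<^sub>R (p - T p)"
    have xu: "x + u = p" "x - u = T p"
      by (simp_all add: x_def u_def flip: scaleR_add_right scaleR_diff_right scaleR_2)
    with that have "u \<in> A x" by (simp add: A_def)
    then have "u \<in> B x" using B(2) by (auto simp: gr_def)
    then show ?thesis using mem_iff_reflected_resolvent[OF B(1), of u x] xu by simp
  qed
  with B(1) show thesis by (rule that)
qed


section \<open>The metric on maximally monotone operators\<close>

lemma saturation_mono: "0 \<le> s \<Longrightarrow> s \<le> t \<Longrightarrow> s / (1 + s) \<le> t / (1 + t)"
  for s t :: real
  by (simp add: field_simps)

lemma saturation_subadditive: "(s + t) / (1 + (s + t)) \<le> s / (1 + s) + t / (1 + t)"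
  if "0 \<le> s" "0 \<le> t" for s t :: real
proof -
  have "(s + t) / (1 + (s + t)) = s / (1 + (s + t)) + t / (1 + (s + t))"
    by (simp add: add_divide_distrib)
  also have "\<dots> \<le> s / (1 + s) + t / (1 + t)"
    using that by (intro add_mono divide_left_mono) auto
  finally show ?thesis .
qed

text \<open>The supremum distance of the reflected resolvents of \<open>A\<close> and \<open>B\<close> on the closed ball of
  radius \<open>n\<close> about \<open>0\<close>. The supremum is finite for maximally monotone operators
  (\<open>ball_dist_bdd\<close>).\<close>

definition ball_dist :: "nat \<Rightarrow> ('a::real_inner) operator \<Rightarrow> 'a operator \<Rightarrow> real" where
  "ball_dist n A B = norm_dist_on_ball n (reflected_resolvent A) (reflected_resolvent B)"

text \<open>The summand of index \<open>n + 1\<close> of the series defining the metric.\<close>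

definition rho_term :: "('a::real_inner) operator \<Rightarrow> 'a operator \<Rightarrow> nat \<Rightarrow> real" where
  "rho_term A B n = 1 / 2 ^ Suc n * (ball_dist (Suc n) A B / (1 + ball_dist (Suc n) A B))"

lemma rho_tilde_eq:
  "A \<in> max_monotone_ops \<Longrightarrow> B \<in> max_monotone_ops \<Longrightarrow> rho_tilde A B = (\<Sum>n. rho_term A B n)"
  by (simp add: rho_tilde_def rho_term_def ball_dist_def)

lemma ball_dist_bdd:
  fixes A :: "('a::{real_inner, complete_space}) operator"
  assumes "A \<in> max_monotone_ops" "B \<in> max_monotone_ops"
  shows "bdd_above ((\<lambda>x. norm (reflected_resolvent A x - reflected_resolvent B x)) ` {x. norm x \<le> r})"
proof (rule bdd_aboveI2)
  fix x :: 'a assume "x \<in> {x. norm x \<le> r}"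
  then have "norm x \<le> r" by simp
  moreover have "norm (reflected_resolvent A x - reflected_resolvent A 0) \<le> norm x"
    "norm (reflected_resolvent B x - reflected_resolvent B 0) \<le> norm x"
    using reflected_resolvent_nonexpansive[of _ x 0] assms by (auto simp: max_monotone_ops_def)
  moreover have "norm (reflected_resolvent A x - reflected_resolvent B x) \<le>
      norm (reflected_resolvent A x - reflected_resolvent A 0)
      + (norm (reflected_resolvent A 0 - reflected_resolvent B 0)
      + norm (reflected_resolvent B 0 - reflected_resolvent B x))"
    by (rule norm_diff_triangle_le[OF order_refl norm_diff_triangle_le[OF order_refl order_refl]])
  ultimately show "norm (reflected_resolvent A x - reflected_resolvent B x)
      \<le> 2 * r + norm (reflected_resolvent A 0 - reflected_resolvent B 0)"
    using norm_minus_commute[of "reflected_resolvent B 0" "reflected_resolvent B x"] by linarith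
qed

lemma norm_diff_le_ball_dist:
  fixes A :: "('a::{real_inner, complete_space}) operator"
  assumes "A \<in> max_monotone_ops" "B \<in> max_monotone_ops" "norm x \<le> real n"
  shows "norm (reflected_resolvent A x - reflected_resolvent B x) \<le> ball_dist n A B"
  unfolding ball_dist_def norm_dist_on_ball_def
  using assms by (intro cSUP_upper ball_dist_bdd) auto

lemma ball_dist_le:
  fixes A :: "('a::real_inner) operator"
  assumes "\<And>x. norm x \<le> real n \<Longrightarrow> norm (reflected_resolvent A x - reflected_resolvent B x) \<le> c"
  shows "ball_dist n A B \<le> c"
  unfolding ball_dist_def norm_dist_on_ball_def
proof (rule cSUP_least)
  have "(0 :: 'a) \<in> {x. norm x \<le> real n}" by simp
  then show "{x :: 'a. norm x \<le> real n} \<noteq> {}" by blast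
qed (use assms in auto)

lemma ball_dist_nonneg:
  fixes A :: "('a::{real_inner, complete_space}) operator"
  assumes "A \<in> max_monotone_ops" "B \<in> max_monotone_ops"
  shows "0 \<le> ball_dist n A B"
  using norm_diff_le_ball_dist[OF assms, of 0 n] norm_ge_zero
  by (metis norm_zero of_nat_0_le_iff order_trans)

lemma ball_dist_triangle:
  fixes A :: "('a::{real_inner, complete_space}) operator"
  assumes "A \<in> max_monotone_ops" "B \<in> max_monotone_ops" "C \<in> max_monotone_ops"
  shows "ball_dist n A C \<le> ball_dist n A B + ball_dist n B C"
proof (rule ball_dist_le)
  fix x :: 'a assume "norm x \<le> real n"
  then show "norm (reflected_resolvent A x - reflected_resolvent C x)
      \<le> ball_dist n A B + ball_dist n B C"
    using norm_diff_le_ball_dist[of A B x n] norm_diff_le_ball_dist[of B C x n] assms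
    by (intro norm_diff_triangle_le) auto
qed

lemma rho_term_bounds:
  fixes A :: "('a::{real_inner, complete_space}) operator"
  assumes "A \<in> max_monotone_ops" "B \<in> max_monotone_ops"
  shows "0 \<le> rho_term A B n" "rho_term A B n \<le> (1/2) ^ Suc n"
    "rho_term A B n \<le> (1/2) ^ Suc n * ball_dist (Suc n) A B"
proof -
  define d where "d = ball_dist (Suc n) A B"
  have d: "0 \<le> d" using ball_dist_nonneg[OF assms] by (simp add: d_def)
  have eq: "rho_term A B n = (1/2) ^ Suc n * (d / (1 + d))"
    by (simp add: rho_term_def d_def power_one_over)
  show "0 \<le> rho_term A B n" unfolding eq using d by simp
  have "(1/2) ^ Suc n * (d / (1 + d)) \<le> (1/2) ^ Suc n * 1"
    using d by (intro mult_left_mono) auto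
  then show "rho_term A B n \<le> (1/2) ^ Suc n" by (simp only: eq mult_1_right)
  have "d / (1 + d) \<le> d / 1" using d by (intro divide_left_mono) auto
  then have "(1/2) ^ Suc n * (d / (1 + d)) \<le> (1/2) ^ Suc n * d"
    by (intro mult_left_mono) auto
  then show "rho_term A B n \<le> (1/2) ^ Suc n * ball_dist (Suc n) A B"
    by (simp only: eq d_def)
qed

lemma summable_half_powers: "summable (\<lambda>n. (1/2 :: real) ^ Suc n)"
  using power_half_series sums_summable by blast

lemma summable_rho_term:
  fixes A :: "('a::{real_inner, complete_space}) operator"
  assumes "A \<in> max_monotone_ops" "B \<in> max_monotone_ops"
  shows "summable (rho_term A B)"
  using rho_term_bounds[OF assms]
  by (intro summable_comparison_test'[OF summable_half_powers, of 0]) simp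

lemma rho_term_le_rho_tilde:
  fixes A :: "('a::{real_inner, complete_space}) operator"
  assumes "A \<in> max_monotone_ops" "B \<in> max_monotone_ops"
  shows "rho_term A B n \<le> rho_tilde A B"
  using sum_le_suminf[OF summable_rho_term[OF assms], of "{n}"] rho_term_bounds(1)[OF assms]
  by (simp add: rho_tilde_eq[OF assms])

lemma reflected_resolvent_inject:
  fixes A :: "('a::{real_inner, complete_space}) operator"
  assumes "A \<in> max_monotone_ops" "B \<in> max_monotone_ops"
    and "reflected_resolvent A = reflected_resolvent B"
  shows "A = B"
proof (intro ext set_eqI)
  fix x u show "u \<in> A x \<longleftrightarrow> u \<in> B x"
    using mem_iff_reflected_resolvent[of A u x] mem_iff_reflected_resolvent[of B u x] assms
    by (simp add: max_monotone_ops_def)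
qed

text \<open>Convergence in the metric implies pointwise convergence of the reflected resolvents.\<close>

lemma norm_diff_lt_of_rho_tilde_lt:
  fixes A :: "('a::{real_inner, complete_space}) operator"
  assumes A: "A \<in> max_monotone_ops" and B: "B \<in> max_monotone_ops" and "norm p \<le> real (Suc n)"
    and e: "0 < e" and rho: "rho_tilde A B < 1 / 2 ^ Suc n * (e / (1 + e))"
  shows "norm (reflected_resolvent A p - reflected_resolvent B p) < e"
proof (rule ccontr)
  assume "\<not> ?thesis"
  then have "e \<le> ball_dist (Suc n) A B"
    using norm_diff_le_ball_dist[OF A B \<open>norm p \<le> _\<close>] by linarith
  then have "1 / 2 ^ Suc n * (e / (1 + e)) \<le> rho_term A B n"
    unfolding rho_term_def using e by (intro mult_left_mono saturation_mono) auto
  with rho rho_term_le_rho_tilde[OF A B, of n] show False by linarith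
qed

theorem Metric_space_rho_tilde:
  "Metric_space (max_monotone_ops :: ('a::{real_inner, complete_space}) operator set) rho_tilde"
proof
  fix A B C :: "'a operator"
  show "0 \<le> rho_tilde A B"
  proof (cases "A \<in> max_monotone_ops \<and> B \<in> max_monotone_ops")
    case True
    then show ?thesis
      using suminf_nonneg[OF summable_rho_term rho_term_bounds(1), of A B] by (simp only: rho_tilde_eq)
  qed (simp only: rho_tilde_def if_False order_refl)
  show "rho_tilde A B = rho_tilde B A"
    by (simp add: rho_tilde_def norm_dist_on_ball_def norm_minus_commute conj_commute)
  assume A: "A \<in> max_monotone_ops" and B: "B \<in> max_monotone_ops"
  show "rho_tilde A B = 0 \<longleftrightarrow> A = B"
  proof
    assume 0: "rho_tilde A B = 0"
    have "reflected_resolvent A p = reflected_resolvent B p" for p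
    proof -
      obtain n where n: "norm p \<le> real n" using real_arch_simple by blast
      have "norm (reflected_resolvent A p - reflected_resolvent B p) < e" if "0 < e" for e
        by (rule norm_diff_lt_of_rho_tilde_lt[OF A B _ that, of _ n]) (use n 0 that in auto)
      then show ?thesis by (metis less_irrefl zero_less_norm_iff right_minus_eq)
    qed
    then show "A = B" using reflected_resolvent_inject[OF A B] by blast
  next
    assume "A = B"
    moreover have "ball_dist n A A = 0" for n
      using ball_dist_le[of n A A 0] ball_dist_nonneg[OF A A, of n] by simp
    ultimately show "rho_tilde A B = 0"
      using A by (simp add: rho_tilde_eq rho_term_def)
  qed
  assume C: "C \<in> max_monotone_ops"
  have "rho_term A C n \<le> rho_term A B n + rho_term B C n" for n
  proof -
    let ?d = "ball_dist (Suc n)"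
    have "?d A C / (1 + ?d A C) \<le> (?d A B + ?d B C) / (1 + (?d A B + ?d B C))"
      using ball_dist_nonneg[OF A C] ball_dist_triangle[OF A B C] by (rule saturation_mono)
    also have "\<dots> \<le> ?d A B / (1 + ?d A B) + ?d B C / (1 + ?d B C)"
      using ball_dist_nonneg[OF A B] ball_dist_nonneg[OF B C] by (rule saturation_subadditive)
    finally show ?thesis
      unfolding rho_term_def distrib_left[symmetric] by (intro mult_left_mono) auto
  qed
  then have "(\<Sum>n. rho_term A C n) \<le> (\<Sum>n. rho_term A B n + rho_term B C n)"
    by (intro suminf_le summable_add summable_rho_term A B C)
  also have "\<dots> = (\<Sum>n. rho_term A B n) + (\<Sum>n. rho_term B C n)"
    by (intro suminf_add[symmetric] summable_rho_term A B C)
  finally show "rho_tilde A C \<le> rho_tilde A B + rho_tilde B C"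
    by (simp add: rho_tilde_eq A B C)
qed

text \<open>Reflected resolvents that are close on a large ball come from operators close in the metric:
  the terms past the \<open>N\<close>-th contribute at most \<open>(1/2) ^ N\<close>.\<close>

lemma rho_tilde_le:
  fixes A :: "('a::{real_inner, complete_space}) operator"
  assumes A: "A \<in> max_monotone_ops" and B: "B \<in> max_monotone_ops"
    and close: "\<And>x. norm x \<le> real N \<Longrightarrow>
      norm (reflected_resolvent A x - reflected_resolvent B x) \<le> \<eta>"
  shows "rho_tilde A B \<le> \<eta> + (1/2) ^ N"
proof -
  have "0 \<le> \<eta>" using close[of 0] norm_ge_zero by (metis norm_zero of_nat_0_le_iff order_trans)
  have half: "(\<Sum>n. (1/2 :: real) ^ Suc n) = 1" using power_half_series by (rule sums_unique[symmetric])
  have head: "(\<Sum>n<N. rho_term A B n) \<le> \<eta>"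
  proof -
    have "(\<Sum>n<N. rho_term A B n) \<le> (\<Sum>n<N. (1/2) ^ Suc n * \<eta>)"
    proof (rule sum_mono)
      fix n assume "n \<in> {..<N}"
      then have "ball_dist (Suc n) A B \<le> \<eta>" by (intro ball_dist_le close) auto
      then have "(1/2) ^ Suc n * ball_dist (Suc n) A B \<le> (1/2) ^ Suc n * \<eta>"
        by (intro mult_left_mono) auto
      then show "rho_term A B n \<le> (1/2) ^ Suc n * \<eta>"
        using rho_term_bounds(3)[OF A B, of n] by linarith
    qed
    also have "\<dots> = (\<Sum>n<N. (1/2) ^ Suc n) * \<eta>" by (simp add: sum_distrib_right)
    also have "\<dots> \<le> 1 * \<eta>"
      using sum_le_suminf[OF summable_half_powers, of "{..<N}"] half \<open>0 \<le> \<eta>\<close>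
      by (intro mult_right_mono) auto
    finally show ?thesis by simp
  qed
  have "(\<Sum>n. rho_term A B (n + N)) \<le> (\<Sum>n. (1/2) ^ N * (1/2) ^ Suc n)"
  proof (rule suminf_le)
    show "rho_term A B (n + N) \<le> (1/2) ^ N * (1/2) ^ Suc n" for n
      using rho_term_bounds(2)[OF A B, of "n + N"] by (simp add: power_add mult.commute)
  qed (use summable_rho_term[OF A B] summable_half_powers in
        \<open>auto intro: summable_ignore_initial_segment summable_mult\<close>)
  also have "\<dots> = (1/2) ^ N"
    using suminf_mult[OF summable_half_powers, of "(1/2) ^ N"] half by simp
  finally show ?thesis
    using suminf_split_initial_segment[OF summable_rho_term[OF A B], of N] head
    by (simp add: rho_tilde_eq[OF A B])
qed

section \<open>Nowhere density of strong monotonicity\<close>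

text \<open>On the ball of radius \<open>N\<close>, every maximally monotone \<open>A\<close> is approximated by some \<open>B\<close> whose
  reflected resolvent translates the pair \<open>0\<close>, \<open>p\<close> rigidly.\<close>

lemma ex_close_isometric_pair:
  fixes A :: "('a::{real_inner, complete_space}) operator"
  assumes nontrivial: "\<exists>x :: 'a. x \<noteq> 0" and A: "A \<in> max_monotone_ops" and "0 < \<eta>"
  obtains B p where "B \<in> max_monotone_ops" "p \<noteq> 0"
    "reflected_resolvent B p - reflected_resolvent B 0 = p"
    "\<And>x. norm x \<le> real N \<Longrightarrow> norm (reflected_resolvent A x - reflected_resolvent B x) \<le> \<eta>"
proof -
  define R where "R = reflected_resolvent A"
  have R: "norm (R x - R y) \<le> norm (x - y)" for x y
    using reflected_resolvent_nonexpansive[of A x y] A by (simp add: R_def max_monotone_ops_def)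
  define M where "M = real N + norm (R 0) + 1"
  have M: "0 < M" by (simp add: M_def add_nonneg_pos)
  \<comment> \<open>On the ball of radius \<open>N\<close> the values of \<open>R\<close> have norm at most \<open>M\<close>,
    so scaling by \<open>1 - \<delta>\<close> moves them by at most \<open>\<eta> / 2\<close>.\<close>
  define \<delta> where "\<delta> = min (1/2) (\<eta> / (2 * M))"
  have \<delta>: "0 < \<delta>" "\<delta> \<le> 1" "\<delta> * M \<le> \<eta> / 2"
    using \<open>0 < \<eta>\<close> M by (auto simp: \<delta>_def min_def field_simps)
  define T where "T = (\<lambda>x. (1 - \<delta>) *\<^sub>R R x)"
  have T: "norm (T x - T y) \<le> (1 - \<delta>) * norm (x - y)" for x y
    using R[of x y] \<delta> by (simp add: T_def mult_left_mono flip: scaleR_diff_right)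
  define r where "r = \<eta> / 4"
  have r: "0 < r" using \<open>0 < \<eta>\<close> by (simp add: r_def)
  \<comment> \<open>The norm of \<open>p\<close>. The inequality \<open>2 * s \<le> \<delta> * r\<close> lets the slack of \<open>T\<close> at distance
    at least \<open>r\<close> absorb both the displacement of \<open>p\<close> and that of its image.\<close>
  define s where "s = \<delta> * r / 2"
  have s: "0 < s" "s \<le> r / 2" "2 * s \<le> \<delta> * r" using r \<delta> by (auto simp: s_def)
  obtain e :: 'a where "e \<noteq> 0" using nontrivial by blast
  define p where "p = (s / norm e) *\<^sub>R e"
  have p: "norm p = s" "p \<noteq> 0" using s \<open>e \<noteq> 0\<close> by (auto simp: p_def)
  define T' where "T' = (\<lambda>x. if x = p then T 0 + p else T x)"
  define D where "D = {0, p} \<union> {x. r \<le> norm x}"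
  have T'p: "norm (T' p - T' x) \<le> norm (p - x)" if x: "x \<in> D" for x
  proof -
    consider "x = p" | "x = 0" "x \<noteq> p" | "r \<le> norm x" "x \<noteq> p"
      using x p(2) unfolding D_def by blast
    then show ?thesis
    proof cases
      case 3
      have "norm (T' p - T' x) = norm (p + (T 0 - T x))" using 3 by (simp add: T'_def algebra_simps)
      also have "\<dots> \<le> s + (1 - \<delta>) * norm x"
        using norm_triangle_ineq[of p "T 0 - T x"] T[of 0 x] p by simp
      also have "\<dots> \<le> norm x - s"
      proof -
        have "\<delta> * r \<le> \<delta> * norm x" using 3(1) \<delta>(1) by (intro mult_left_mono) auto
        with s(3) show ?thesis by (simp add: left_diff_distrib)
      qed
      also have "\<dots> \<le> norm (p - x)" using p norm_triangle_ineq2[of x p] by (simp add: norm_minus_commute)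
      finally show ?thesis .
    qed (auto simp: T'_def)
  qed
  have "norm (T' x - T' y) \<le> norm (x - y)" if xy: "x \<in> D" "y \<in> D" for x y
  proof -
    consider "x = p" | "y = p" | "x \<noteq> p" "y \<noteq> p" by blast
    then show ?thesis
    proof cases
      case 1 then show ?thesis using T'p[OF xy(2)] by simp
    next
      case 2 then show ?thesis using T'p[OF xy(1)] by (simp add: norm_minus_commute)
    next
      case 3
      have "(1 - \<delta>) * norm (x - y) \<le> 1 * norm (x - y)" using \<delta> by (intro mult_right_mono) auto
      with 3 T[of x y] show ?thesis by (simp add: T'_def)
    qed
  qed
  then obtain B where B: "maximally_monotone B"
    and BD: "\<And>x. x \<in> D \<Longrightarrow> reflected_resolvent B x = T' x"
    using nonexpansive_extension by blast
  have B0: "reflected_resolvent B 0 = T 0" using BD[of 0] p by (auto simp: D_def T'_def)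
  \<comment> \<open>Inside the ball of radius \<open>r\<close> the values of \<open>B\<close>'s reflected resolvent are not known,
    but both maps are nonexpansive and agree at \<open>0\<close>.\<close>
  have TB: "norm (T x - reflected_resolvent B x) \<le> \<eta> / 2" for x
  proof (cases "r \<le> norm x")
    case True
    moreover from this have "x \<noteq> p" using p s r by auto
    ultimately have "reflected_resolvent B x = T x" using BD[of x] by (simp add: D_def T'_def)
    then show ?thesis using \<open>0 < \<eta>\<close> by simp
  next
    case False
    have "(1 - \<delta>) * norm x \<le> 1 * norm x" using \<delta> by (intro mult_right_mono) auto
    then have "norm (T x - T 0) \<le> r" using T[of x 0] False by simp
    moreover have "norm (T 0 - reflected_resolvent B x) \<le> r"
      using reflected_resolvent_nonexpansive[OF B, of 0 x] False B0 by simp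
    ultimately have "norm (T x - reflected_resolvent B x) \<le> r + r" by (rule norm_diff_triangle_le)
    then show ?thesis by (simp add: r_def)
  qed
  show thesis
  proof (rule that)
    show "B \<in> max_monotone_ops" using B by (simp add: max_monotone_ops_def)
    show "p \<noteq> 0" by fact
    show "reflected_resolvent B p - reflected_resolvent B 0 = p"
      using BD[of p] B0 by (simp add: D_def T'_def)
    show "norm (reflected_resolvent A x - reflected_resolvent B x) \<le> \<eta>"
      if x: "norm x \<le> real N" for x
    proof -
      have "norm (R x) \<le> M"
        using R[of x 0] norm_triangle_ineq2[of "R x" "R 0"] x by (simp add: M_def)
      then have "\<delta> * norm (R x) \<le> \<delta> * M" using \<delta> by (intro mult_left_mono) auto
      moreover have "R x - T x = \<delta> *\<^sub>R R x" by (simp add: T_def algebra_simps)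
      ultimately have "norm (R x - T x) \<le> \<eta> / 2" using \<delta>(1,3) by (simp only: norm_scaleR)
      then have "norm (R x - reflected_resolvent B x) \<le> \<eta> / 2 + \<eta> / 2"
        using TB by (rule norm_diff_triangle_le)
      then show ?thesis by (simp add: R_def)
    qed
  qed
qed

lemma nowhere_dense_strongly_monotone:
  assumes nontrivial: "\<exists>x :: 'a::{real_inner, complete_space}. x \<noteq> 0" and "0 < \<epsilon>"
  shows "nowhere_dense_in (Metric_space.mtopology (max_monotone_ops :: 'a operator set) rho_tilde)
           {A \<in> max_monotone_ops. strongly_monotone_op \<epsilon> A}"
proof -
  interpret Metric_space "max_monotone_ops :: 'a operator set" rho_tilde
    by (rule Metric_space_rho_tilde)
  let ?S = "{A \<in> (max_monotone_ops :: 'a operator set). strongly_monotone_op \<epsilon> A}"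
  \<comment> \<open>The set is closed.\<close>
  have closure: "B \<in> ?S" if "B \<in> mtopology closure_of ?S" for B
  proof -
    have B: "B \<in> max_monotone_ops" using that by (simp add: metric_closure_of)
    have "\<forall>k. \<exists>C. C \<in> ?S \<and> rho_tilde B C < inverse (real (Suc k))"
      using that unfolding metric_closure_of by fastforce
    from choice[OF this] obtain C
      where C: "\<And>k. C k \<in> ?S" "\<And>k. rho_tilde B (C k) < inverse (real (Suc k))"
      by blast
    have lim: "(\<lambda>k. reflected_resolvent (C k) p) \<longlonglongrightarrow> reflected_resolvent B p" for p
    proof (rule metric_LIMSEQ_I)
      fix e :: real assume e: "0 < e"
      obtain n where n: "norm p \<le> real n" using real_arch_simple by blast
      have "0 < 1 / 2 ^ Suc n * (e / (1 + e))" using e by simp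
      then obtain k0 where k0: "inverse (real (Suc k0)) < 1 / 2 ^ Suc n * (e / (1 + e))"
        using reals_Archimedean by blast
      have "dist (reflected_resolvent (C k) p) (reflected_resolvent B p) < e" if "k0 \<le> k" for k
      proof -
        have "inverse (real (Suc k)) \<le> inverse (real (Suc k0))" using that by simp
        then have "rho_tilde B (C k) < 1 / 2 ^ Suc n * (e / (1 + e))"
          using C(2)[of k] k0 by linarith
        then show ?thesis
          using norm_diff_lt_of_rho_tilde_lt[OF B, of "C k" p n e] C(1)[of k] n e
          by (simp add: dist_norm norm_minus_commute)
      qed
      then show "\<exists>k0. \<forall>k\<ge>k0. dist (reflected_resolvent (C k) p) (reflected_resolvent B p) < e"
        by blast
    qed
    have "\<epsilon> * (norm ((p - q) + (reflected_resolvent B p - reflected_resolvent B q)))\<^sup>2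
        \<le> (norm (p - q))\<^sup>2 - (norm (reflected_resolvent B p - reflected_resolvent B q))\<^sup>2" for p q
    proof (rule LIMSEQ_le)
      let ?f = "\<lambda>k. reflected_resolvent (C k) p - reflected_resolvent (C k) q"
      show "(\<lambda>k. \<epsilon> * (norm ((p - q) + ?f k))\<^sup>2) \<longlonglongrightarrow>
          \<epsilon> * (norm ((p - q) + (reflected_resolvent B p - reflected_resolvent B q)))\<^sup>2"
        by (intro tendsto_intros lim)
      show "(\<lambda>k. (norm (p - q))\<^sup>2 - (norm (?f k))\<^sup>2) \<longlonglongrightarrow>
          (norm (p - q))\<^sup>2 - (norm (reflected_resolvent B p - reflected_resolvent B q))\<^sup>2"
        by (intro tendsto_intros lim)
      show "\<exists>N. \<forall>k\<ge>N. \<epsilon> * (norm ((p - q) + ?f k))\<^sup>2 \<le> (norm (p - q))\<^sup>2 - (norm (?f k))\<^sup>2"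
      proof (intro exI allI impI)
        fix k
        have "maximally_monotone (C k)" "strongly_monotone_op \<epsilon> (C k)"
          using C(1)[of k] by (auto simp: max_monotone_ops_def)
        then show "\<epsilon> * (norm ((p - q) + ?f k))\<^sup>2 \<le> (norm (p - q))\<^sup>2 - (norm (?f k))\<^sup>2"
          using strongly_monotone_iff_reflected_resolvent by blast
      qed
    qed
    then show ?thesis
      using B strongly_monotone_iff_reflected_resolvent[of B \<epsilon>] by (simp add: max_monotone_ops_def)
  qed
  have "mtopology interior_of (mtopology closure_of ?S) = {}"
  proof (rule ccontr)
    assume "mtopology interior_of (mtopology closure_of ?S) \<noteq> {}"
    then obtain A U where U: "openin mtopology U" "U \<subseteq> mtopology closure_of ?S" "A \<in> U"
      by (auto simp: interior_of_def)
    then obtain \<tau> where A: "A \<in> max_monotone_ops" and "0 < \<tau>" and "mball A \<tau> \<subseteq> U"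
      unfolding openin_mtopology by blast
    with U(2) closure have ball: "mball A \<tau> \<subseteq> ?S" by blast
    obtain N where N: "(1/2) ^ N < \<tau> / 2"
      using real_arch_pow_inv[of "\<tau> / 2" "1/2"] \<open>0 < \<tau>\<close> by auto
    obtain B p where B: "B \<in> max_monotone_ops" and p: "p \<noteq> 0"
      "reflected_resolvent B p - reflected_resolvent B 0 = p"
      and close: "\<And>x. norm x \<le> real N \<Longrightarrow>
        norm (reflected_resolvent A x - reflected_resolvent B x) \<le> \<tau> / 2"
      using ex_close_isometric_pair[OF nontrivial A half_gt_zero[OF \<open>0 < \<tau>\<close>], of N] by blast
    have "rho_tilde A B < \<tau>" using rho_tilde_le[where N = N, OF A B close] N by linarith
    then have "strongly_monotone_op \<epsilon> B" using ball A B by auto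
    then have "\<epsilon> * (norm ((p - 0) + p))\<^sup>2 \<le> (norm (p - 0))\<^sup>2 - (norm p)\<^sup>2"
      using strongly_monotone_iff_reflected_resolvent[of B \<epsilon>] B p(2)
      by (metis (no_types, lifting) max_monotone_ops_def mem_Collect_eq)
    \<comment> \<open>The right-hand side vanishes, the left-hand side does not.\<close>
    moreover have "p + p \<noteq> 0" using p(1) by (metis scaleR_2 scaleR_eq_0_iff zero_neq_numeral)
    then have "0 < \<epsilon> * (norm (p + p))\<^sup>2" using \<open>0 < \<epsilon>\<close> by simp
    ultimately show False by simp
  qed
  then show ?thesis by (auto simp: nowhere_dense_in_def)
qed

lemma strongly_monotone_op_antimono:
  assumes "strongly_monotone_op \<epsilon> A" "\<delta> \<le> \<epsilon>"
  shows "strongly_monotone_op \<delta> A"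
  using assms mult_right_mono[OF assms(2) inner_ge_zero]
  unfolding strongly_monotone_op_iff by (meson order_trans)

theorem corollary3p10:
  assumes nontrivial: "\<exists>x :: 'a::{real_inner, complete_space}. x \<noteq> 0"
  shows "first_category_in
           (Metric_space.mtopology (max_monotone_ops :: 'a operator set) rho_tilde)
           {A \<in> (max_monotone_ops :: 'a operator set). \<exists>\<epsilon> > 0. strongly_monotone_op \<epsilon> A}"
proof -
  define S where "S = (\<lambda>\<epsilon>. {A \<in> (max_monotone_ops :: 'a operator set). strongly_monotone_op \<epsilon> A})"
  have "{A \<in> (max_monotone_ops :: 'a operator set). \<exists>\<epsilon> > 0. strongly_monotone_op \<epsilon> A}
      = (\<Union>n. S (inverse (real (Suc n))))" (is "?L = ?R")
  proof
    show "?L \<subseteq> ?R"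
    proof
      fix A assume "A \<in> ?L"
      then obtain \<epsilon> where A: "A \<in> max_monotone_ops" "0 < \<epsilon>" "strongly_monotone_op \<epsilon> A" by blast
      obtain n where "inverse (real (Suc n)) < \<epsilon>" using reals_Archimedean[OF A(2)] by blast
      then have "strongly_monotone_op (inverse (real (Suc n))) A"
        using strongly_monotone_op_antimono[OF A(3)] by simp
      with A(1) show "A \<in> ?R" by (auto simp: S_def)
    qed
    show "?R \<subseteq> ?L"
    proof
      fix A assume "A \<in> ?R"
      then obtain n where "A \<in> S (inverse (real (Suc n)))" by blast
      moreover have "0 < inverse (real (Suc n))" by simp
      ultimately show "A \<in> ?L" unfolding S_def by blast
    qed
  qed
  moreover have "nowhere_dense_in
      (Metric_space.mtopology (max_monotone_ops :: 'a operator set) rho_tilde)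
      (S (inverse (real (Suc n))))" for n
    unfolding S_def by (rule nowhere_dense_strongly_monotone[OF nontrivial]) simp
  ultimately show ?thesis
    unfolding first_category_in_def
    by (intro exI[of _ "range (\<lambda>n. S (inverse (real (Suc n))))"]) auto
qed

end
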